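(* Let $\underline f_0=\bar f_0=0$, $\bar f_j=\bar f$ and $\underline f_j=-\bar f$ for $j\in\{1,\dots,n\}$, where $0\le d<\bar f$, and $x_0:=1$. Let $$\mathcal{S}=\Big\{(x,f)\in\{0,1\}^n\times\mathbb{R}^{n+1}:\ \sum_{j=0}^n f_j=d,\ \ \underline f_j x_j\le f_j\le \bar f_j x_j,\ j\in\{0,1,\dots,n\}\Big\}$$ and $$\mathcal{O}=\bigcup_{k=0}^n\Big\{(x,f)\in[0,1]^n\times\mathbb{R}^{n+1}:\ \sum_{j=0}^n f_j=d,\ \underline f_jx_j\le f_j\le\bar f_jx_j,\ j\in\{0,\dots,n\},\ f_k\in\operatorname{conv}(V_k),\ x_k=1\Big\}.$$ Then $\operatorname{conv}(\mathcal{O})=\operatorname{conv}(\mathcal{S})$.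
   Context: Coordinates: $x=(x_1,\dots,x_n)$ and $f=(f_0,\dots,f_n)$; $x_0$ is the constant $1$ (so for $k=0$ the condition $x_k=1$ holds automatically). Let $E_0=\{\underline f_0,\bar f_0\}$ and $E_j=\{-\bar f_j,0,\bar f_j\}$ for $j\in\{1,\dots,n\}$. For $k\in\{0,\dots,n\}$, $$V_k=\Big\{f_k=d-\sum_{j\in\{0,\dots,n\}\setminus\{k\}}f_j:\ f_j\in E_j\ \text{for } j\ne k,\ \ \underline f_k\le f_k\le\bar f_k\Big\}.$$ The convex hull of the empty set is empty. *)

theory Defs
  imports "HOL-Analysis.Analysis"
begin

text \<open>
  The indices \<open>1, \<dots>, n\<close> are the elements of a finite type \<open>'n\<close> with \<open>CARD('n) = n\<close>;
  the indices \<open>0, 1, \<dots>, n\<close> are the elements of \<open>'n option\<close>, where \<open>None\<close> is the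
  index \<open>0\<close> and \<open>Some j\<close> is the index \<open>j \<ge> 1\<close>.  So \<open>x\<close> has type \<open>real ^ 'n\<close> and \<open>f\<close>,
  like its lower bounds \<open>fl\<close> and upper bounds \<open>fu\<close>, has type \<open>real ^ ('n option)\<close>.
\<close>

text \<open>The coordinates of \<open>x\<close>, extended by \<open>x\<^sub>0 = 1\<close>.\<close>

definition xcoord :: "real ^ 'n \<Rightarrow> 'n option \<Rightarrow> real" where
  "xcoord x k = (case k of None \<Rightarrow> 1 | Some j \<Rightarrow> x $ j)"

definition E_set :: "real ^ ('n::finite option) \<Rightarrow> real ^ ('n option) \<Rightarrow> 'n option \<Rightarrow> real set" where
  "E_set fl fu k =
     (case k of
        None \<Rightarrow> {fl $ None, fu $ None}
      | Some j \<Rightarrow> {- (fu $ Some j), 0, fu $ Some j})"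

definition V_set ::
  "real ^ ('n::finite option) \<Rightarrow> real ^ ('n option) \<Rightarrow> real \<Rightarrow> 'n option \<Rightarrow> real set" where
  "V_set fl fu d k =
     {f $ k | f :: real ^ ('n option).
        f $ k = d - (\<Sum>j\<in>UNIV - {k}. f $ j) \<and>
        (\<forall>j. j \<noteq> k \<longrightarrow> f $ j \<in> E_set fl fu j) \<and>
        fl $ k \<le> f $ k \<and> f $ k \<le> fu $ k}"

definition S_set ::
  "real ^ ('n::finite option) \<Rightarrow> real ^ ('n option) \<Rightarrow> real \<Rightarrow> ((real ^ 'n) \<times> (real ^ ('n option))) set"
  where
  "S_set fl fu d =
     {(x, f).
        (\<forall>i. x $ i \<in> {0, 1}) \<and>
        (\<Sum>j\<in>UNIV. f $ j) = d \<and>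
        (\<forall>j. fl $ j * xcoord x j \<le> f $ j \<and> f $ j \<le> fu $ j * xcoord x j)}"

definition O_set ::
  "real ^ ('n::finite option) \<Rightarrow> real ^ ('n option) \<Rightarrow> real \<Rightarrow> ((real ^ 'n) \<times> (real ^ ('n option))) set"
  where
  "O_set fl fu d =
     (\<Union>k\<in>UNIV.
       {(x, f).
          (\<forall>i. x $ i \<in> {0..1}) \<and>
          (\<Sum>j\<in>UNIV. f $ j) = d \<and>
          (\<forall>j. fl $ j * xcoord x j \<le> f $ j \<and> f $ j \<le> fu $ j * xcoord x j) \<and>
          f $ k \<in> convex hull (V_set fl fu d k) \<and>
          xcoord x k = 1})"

end

theory Submission
  imports Defs
begin

text \<open>
  Write \<open>u\<close> for the common capacity \<open>fbar\<close>. Each inclusion is checked on extreme points, with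
  the help of the Krein--Milman theorem: the disjunct \<open>k\<close> of \<open>O_set\<close>, and the part of \<open>S_set\<close>
  over a fixed binary \<open>x\<close>, are compact convex sets, so it suffices to place their extreme points
  in the other set.

  All these sets have the form \<open>coupled_polytope C d\<close>: every pair \<open>(x\<^sub>j, f\<^sub>j)\<close> lies in a planar
  set \<open>C j\<close>, and the only coupling between different \<open>j\<close> is the equation \<open>\<Sum>f\<^sub>j = d\<close>. Call a
  coordinate movable if its flow can be changed slightly in both directions within \<open>C j\<close>, with
  \<open>x\<^sub>j\<close> allowed to follow linearly. If two coordinates are movable, an amount of flow can be
  exchanged between them in either direction, so the point is not extreme
  (\<open>extreme_point_movable_unique\<close>). A flow is called fractional if it lies outside
  \<open>{-u, 0, u}\<close>. In both families a coordinate with fractional flow is movable, except perhaps the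
  coordinate \<open>k\<close> in the disjunct \<open>k\<close>.

  At an extreme point of the part of \<open>S_set\<close> over \<open>x\<close>, at most one flow is fractional. Let \<open>k\<close> be
  its index, or \<open>0\<close> if there is none. The point itself then witnesses \<open>f\<^sub>k \<in> V\<^sub>k\<close>, so it lies
  in the disjunct \<open>k\<close> of \<open>O_set\<close>.

  In the disjunct \<open>k \<noteq> 0\<close>, the coordinate \<open>k\<close> is movable as soon as \<open>f\<^sub>k \<notin> V\<^sub>k\<close>; for \<open>k = 0\<close>,
  every point of the disjunct has \<open>f\<^sub>0 \<in> V\<^sub>0\<close>. No \<open>f\<^sub>j\<close> with \<open>j \<noteq> k\<close> can be fractional at an extreme point: \<open>j\<close> would be
  the only movable coordinate, so \<open>f\<^sub>k \<in> V\<^sub>k\<close> would be congruent to \<open>d\<close> modulo \<open>u\<close>, all flows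
  other than \<open>f\<^sub>k\<close> and \<open>f\<^sub>j\<close> would be multiples of \<open>u\<close>, and by conservation \<open>f\<^sub>j\<close> would be one
  too (\<open>extreme_point_disjunct_flows\<close>). Therefore all flows other than \<open>f\<^sub>k\<close> are in \<open>{-u, 0, u}\<close>, and
  extremality in \<open>x\<close> makes \<open>x\<close> binary.
\<close>

section \<open>Polytopes with a single coupling equation\<close>

lemma xcoord_simps [simp]: "xcoord x None = 1" "xcoord x (Some i) = x $ i"
  by (simp_all add: xcoord_def)

definition coupled_polytope ::
  "('n::finite option \<Rightarrow> (real \<times> real) set) \<Rightarrow> real \<Rightarrow> ((real ^ 'n) \<times> (real ^ ('n option))) set"
  where
  "coupled_polytope C d = {(x, f). (\<Sum>j\<in>UNIV. f $ j) = d \<and> (\<forall>j. (xcoord x j, f $ j) \<in> C j)}"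

lemma convex_coupled_polytope:
  assumes "\<And>j. convex (C j)"
  shows "convex (coupled_polytope C d)"
proof (rule convexI)
  fix p q :: "(real ^ 'a) \<times> (real ^ ('a option))" and r s :: real
  assume p: "p \<in> coupled_polytope C d" and q: "q \<in> coupled_polytope C d"
    and rs: "0 \<le> r" "0 \<le> s" "r + s = 1"
  obtain x f y g where pq: "p = (x, f)" "q = (y, g)" by (metis surj_pair)
  have "(xcoord (r *\<^sub>R x + s *\<^sub>R y) j, (r *\<^sub>R f + s *\<^sub>R g) $ j) \<in> C j" for j
  proof -
    have "r *\<^sub>R (xcoord x j, f $ j) + s *\<^sub>R (xcoord y j, g $ j) \<in> C j"
      using p q pq rs assms[of j] by (intro convexD) (auto simp: coupled_polytope_def)
    moreover have "xcoord (r *\<^sub>R x + s *\<^sub>R y) j = r * xcoord x j + s * xcoord y j"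
      using rs by (cases j) (auto simp: algebra_simps)
    ultimately show ?thesis by simp
  qed
  moreover have "(\<Sum>j\<in>UNIV. (r *\<^sub>R f + s *\<^sub>R g) $ j) = d"
  proof -
    have "(\<Sum>j\<in>UNIV. (r *\<^sub>R f + s *\<^sub>R g) $ j) = r * (\<Sum>j\<in>UNIV. f $ j) + s * (\<Sum>j\<in>UNIV. g $ j)"
      by (simp add: sum.distrib sum_distrib_left)
    also have "\<dots> = r * d + s * d"
      using p q pq by (simp add: coupled_polytope_def)
    finally show ?thesis using rs by (metis distrib_right mult_1)
  qed
  ultimately show "r *\<^sub>R p + s *\<^sub>R q \<in> coupled_polytope C d"
    by (simp add: pq coupled_polytope_def)
qed

lemma compact_coupled_polytope:
  fixes C :: "'n::finite option \<Rightarrow> (real \<times> real) set"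
  assumes cl: "\<And>j. closed (C j)" and bd: "\<And>j. C j \<subseteq> {0..1} \<times> {-u..u}"
  shows "compact (coupled_polytope C d)"
proof -
  have cont: "continuous_on UNIV (\<lambda>p :: (real ^ 'n) \<times> (real ^ ('n option)). xcoord (fst p) j)" for j
    by (cases j) (auto intro!: continuous_intros)
  have eq: "coupled_polytope C d =
      {p. (\<Sum>j\<in>UNIV. snd p $ j) = d} \<inter> (\<Inter>j. (\<lambda>p. (xcoord (fst p) j, snd p $ j)) -` C j)"
    by (auto simp: coupled_polytope_def)
  have "closed (coupled_polytope C d)"
    unfolding eq
    by (intro closed_Int closed_INT ballI closed_vimage cl closed_Collect_eq
        continuous_intros continuous_on_Pair cont)
  moreover have "bounded (coupled_polytope C d)"
  proof (rule bounded_subset)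
    show "bounded (cbox (0 :: real ^ 'n) 1 \<times> cbox (\<chi> j. - u :: real ^ ('n option)) (\<chi> j. u))"
      by (intro bounded_Times bounded_cbox)
    show "coupled_polytope C d \<subseteq> cbox 0 1 \<times> cbox (\<chi> j. - u) (\<chi> j. u)"
    proof clarify
      fix x :: "real ^ 'n" and f :: "real ^ ('n option)"
      assume "(x, f) \<in> coupled_polytope C d"
      then have *: "(xcoord x j, f $ j) \<in> {0..1} \<times> {-u..u}" for j
        using bd[of j] by (auto simp: coupled_polytope_def)
      have "x \<in> cbox 0 1" using *[of "Some _"] by (auto simp: mem_box_cart)
      moreover have "f \<in> cbox (\<chi> j. - u) (\<chi> j. u)" using * by (auto simp: mem_box_cart)
      ultimately show "x \<in> cbox 0 1 \<and> f \<in> cbox (\<chi> j. - u) (\<chi> j. u)" by blast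
    qed
  qed
  ultimately show ?thesis by (simp add: compact_eq_bounded_closed)
qed

lemma extreme_point_no_line:
  fixes z v :: "'a::euclidean_space"
  assumes "z extreme_point_of P" "z + v \<in> P" "z - v \<in> P"
  shows "v = 0"
proof (rule ccontr)
  assume "v \<noteq> 0"
  moreover have "(z + v) - (z - v) = 2 *\<^sub>R v" by (simp add: scaleR_2)
  ultimately have "z + v \<noteq> z - v" by (metis diff_self scaleR_eq_0_iff zero_neq_numeral)
  then have "midpoint (z + v) (z - v) \<in> open_segment (z + v) (z - v)" by simp
  moreover have "midpoint (z + v) (z - v) = z"
  proof -
    have "(z + v) + (z - v) = 2 *\<^sub>R z" by (simp add: scaleR_2)
    then show ?thesis by (simp add: midpoint_def)
  qed
  ultimately show False using assms by (auto simp: extreme_point_of_def)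
qed

text \<open>
  The slope \<open>s\<close> lets \<open>a\<close> follow the flow: where a constraint \<open>\<bar>b\<bar> \<le> u * a\<close> is tight, \<open>b\<close>
  cannot move alone.
\<close>

definition movable :: "(real \<times> real) set \<Rightarrow> real \<Rightarrow> real \<Rightarrow> bool" where
  "movable C a b \<longleftrightarrow> (\<exists>s e. 0 < e \<and> (\<forall>t. \<bar>t\<bar> \<le> e \<longrightarrow> (a + s * t, b + t) \<in> C))"

text \<open>
  The flow that one movable coordinate gains is taken from the other, which keeps the sum of all
  flows; both directions of the exchange are possible, so the point is the midpoint of a segment.
\<close>

lemma extreme_point_movable_unique:
  fixes C :: "'n::finite option \<Rightarrow> (real \<times> real) set"
  assumes ext: "(x, f) extreme_point_of coupled_polytope C d"
    and a: "movable (C (Some a)) (x $ a) (f $ Some a)"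
    and b: "movable (C (Some b)) (x $ b) (f $ Some b)"
  shows "a = b"
proof (rule ccontr)
  assume ab: "a \<noteq> b"
  obtain s e where e: "0 < e"
    and se: "\<And>t. \<bar>t\<bar> \<le> e \<Longrightarrow> (x $ a + s * t, f $ Some a + t) \<in> C (Some a)"
    using a by (auto simp: movable_def)
  obtain s' e' where e': "0 < e'"
    and se': "\<And>t. \<bar>t\<bar> \<le> e' \<Longrightarrow> (x $ b + s' * t, f $ Some b + t) \<in> C (Some b)"
    using b by (auto simp: movable_def)
  define y :: "real ^ 'n" where "y = s *\<^sub>R axis a 1 - s' *\<^sub>R axis b 1"
  define g :: "real ^ ('n option)" where "g = axis (Some a) 1 - axis (Some b) 1"
  have mem: "(x, f) \<in> coupled_polytope C d"
    using ext by (simp add: extreme_point_of_def)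
  have sum_g: "(\<Sum>j\<in>UNIV. g $ j) = 0"
    by (simp add: g_def sum_subtractf axis_def)
  have shift: "(x, f) + t *\<^sub>R (y, g) \<in> coupled_polytope C d" if t: "\<bar>t\<bar> \<le> min e e'" for t
  proof -
    have "(xcoord (x + t *\<^sub>R y) j, (f + t *\<^sub>R g) $ j) \<in> C j" for j
    proof (cases "j = Some a \<or> j = Some b")
      case True
      then show ?thesis
        using se[of t] se'[of "- t"] t ab by (auto simp: y_def g_def axis_def mult.commute)
    next
      case False
      then have "xcoord (x + t *\<^sub>R y) j = xcoord x j" "(f + t *\<^sub>R g) $ j = f $ j"
        by (cases j; auto simp: y_def g_def axis_def)+
      moreover have "(xcoord x j, f $ j) \<in> C j" using mem by (simp add: coupled_polytope_def)
      ultimately show ?thesis by (simp only:)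
    qed
    moreover have "(\<Sum>j\<in>UNIV. (f + t *\<^sub>R g) $ j) = d"
      using mem sum_g by (simp add: coupled_polytope_def sum.distrib sum_distrib_left[symmetric])
    ultimately show ?thesis by (simp add: coupled_polytope_def)
  qed
  have "min e e' *\<^sub>R (y, g) = 0"
    using extreme_point_no_line[OF ext, of "min e e' *\<^sub>R (y, g)"]
      shift[of "min e e'"] shift[of "- min e e'"] e e' by simp
  then have "g = 0" using e e' by (simp add: zero_prod_def min_def split: if_splits)
  moreover have "g $ Some a = 1" using ab by (simp add: g_def axis_def)
  ultimately show False by simp
qed

text \<open>The coordinates of \<open>x\<close> do not enter the coupling equation, so they move one at a time.\<close>

lemma extreme_point_x_rigid:
  fixes C :: "'n::finite option \<Rightarrow> (real \<times> real) set"
  assumes ext: "(x, f) extreme_point_of coupled_polytope C d"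
    and plus: "(x $ a + e, f $ Some a) \<in> C (Some a)"
    and minus: "(x $ a - e, f $ Some a) \<in> C (Some a)"
  shows "e = 0"
proof -
  have mem: "(x, f) \<in> coupled_polytope C d"
    using ext by (simp add: extreme_point_of_def)
  have shift: "(x, f) + t *\<^sub>R (axis a 1, 0) \<in> coupled_polytope C d"
    if t: "(x $ a + t, f $ Some a) \<in> C (Some a)" for t
  proof -
    have "(xcoord (x + t *\<^sub>R axis a 1) j, f $ j) \<in> C j" for j
    proof (cases "j = Some a")
      case True
      then show ?thesis using t by (simp add: axis_def)
    next
      case False
      then have "xcoord (x + t *\<^sub>R axis a 1) j = xcoord x j"
        by (cases j) (auto simp: axis_def)
      then show ?thesis using mem by (simp add: coupled_polytope_def)
    qed
    then show ?thesis using mem by (simp add: coupled_polytope_def)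
  qed
  have "e *\<^sub>R (axis a 1 :: real ^ 'n, 0 :: real ^ ('n option)) = 0"
    using extreme_point_no_line[OF ext, of "e *\<^sub>R (axis a 1, 0)"] shift[of e] shift[of "- e"]
      plus minus by simp
  then have "(e *\<^sub>R axis a 1 :: real ^ 'n) $ a = 0" by (simp add: zero_prod_def)
  then show ?thesis by (simp add: axis_def)
qed

section \<open>Movable coordinates\<close>

lemma movable_capacity:
  fixes a b u :: real
  assumes a: "0 \<le> a" "a \<le> 1" and b: "\<bar>b\<bar> \<le> u * a" and frac: "b \<notin> {- u, 0, u}" and u: "0 < u"
  shows "movable {(a, b). 0 \<le> a \<and> a \<le> 1 \<and> \<bar>b\<bar> \<le> u * a} a b"
proof (cases "a = 1")
  case True
  then show ?thesis
    using b frac unfolding movable_def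
    by (intro exI[of _ 0] exI[of _ "u - \<bar>b\<bar>"]) auto
next
  case False
  \<comment> \<open>Below the cap \<open>a = 1\<close> the bound \<open>\<bar>b\<bar> \<le> u * a\<close> may be tight: \<open>a\<close> moves so that
    \<open>u * a - \<bar>b\<bar>\<close> stays constant.\<close>
  have "(a + sgn b / u * t, b + t) \<in> {(a, b). 0 \<le> a \<and> a \<le> 1 \<and> \<bar>b\<bar> \<le> u * a}"
    if t: "\<bar>t\<bar> \<le> min \<bar>b\<bar> (u * (1 - a))" for t
  proof -
    have 1: "\<bar>b + t\<bar> = \<bar>b\<bar> + sgn b * t" using t by (auto simp: sgn_if)
    have 2: "u * (a + sgn b / u * t) = u * a + sgn b * t" using u by (simp add: field_simps)
    have bound: "\<bar>b + t\<bar> \<le> u * (a + sgn b / u * t)" using 1 2 b by simp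
    then have "0 \<le> u * (a + sgn b / u * t)" by linarith
    then have "0 \<le> a + sgn b / u * t" using u by (simp only: zero_le_mult_iff) auto
    moreover have "sgn b * t \<le> u * (1 - a)" using t by (auto simp: sgn_if)
    then have "u * (a + sgn b / u * t) \<le> u * 1" using 2 by (simp add: algebra_simps)
    then have "a + sgn b / u * t \<le> 1" using u by (simp only: mult_le_cancel_left_pos)
    ultimately show ?thesis using bound by simp
  qed
  moreover have "0 < min \<bar>b\<bar> (u * (1 - a))" using False a u frac by auto
  ultimately show ?thesis unfolding movable_def by blast
qed

text \<open>
  A point of the hull of a set of reals that is not itself in the set has elements of the set on
  both sides. This is what makes the coordinate \<open>k\<close> of the disjunct \<open>k\<close> movable when
  \<open>f\<^sub>k \<notin> V\<^sub>k\<close>.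
\<close>

lemma convex_hull_real_not_generator:
  fixes b :: real
  assumes b: "b \<in> convex hull V" "b \<notin> V"
  obtains e where "0 < e" "\<And>t. \<bar>t\<bar> \<le> e \<Longrightarrow> b + t \<in> convex hull V"
proof -
  have "\<exists>l\<in>V. l < b"
  proof (rule ccontr)
    assume "\<not> ?thesis"
    then have "V \<subseteq> {b<..}" using b by (metis greaterThan_iff linorder_cases subsetI)
    then have "convex hull V \<subseteq> {b<..}" by (intro hull_minimal) auto
    then show False using b by auto
  qed
  moreover have "\<exists>r\<in>V. b < r"
  proof (rule ccontr)
    assume "\<not> ?thesis"
    then have "V \<subseteq> {..<b}" using b by (metis lessThan_iff linorder_cases subsetI)
    then have "convex hull V \<subseteq> {..<b}" by (intro hull_minimal) auto
    then show False using b by auto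
  qed
  ultimately obtain l r where lr: "l \<in> V" "r \<in> V" "l < b" "b < r" by blast
  have "closed_segment l r \<subseteq> convex hull V"
    using lr by (intro closed_segment_subset_convex_hull hull_inc)
  then have "{l..r} \<subseteq> convex hull V"
    using lr by (simp add: closed_segment_eq_real_ivl)
  then have "b + t \<in> convex hull V" if "\<bar>t\<bar> \<le> min (b - l) (r - b)" for t
    by (rule subsetD) (use that in auto)
  then show ?thesis
    using lr by (intro that[of "min (b - l) (r - b)"]) auto
qed

section \<open>Multiples of the capacity\<close>

definition multiples :: "real \<Rightarrow> real set" where
  "multiples u = range (\<lambda>m::int. u * of_int m)"

lemma multiples_diff: "a \<in> multiples u \<Longrightarrow> b \<in> multiples u \<Longrightarrow> a - b \<in> multiples u"
  unfolding multiples_def by (auto simp: right_diff_distrib[symmetric] simp flip: of_int_diff)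

lemma multiples_sum:
  assumes "\<And>j. j \<in> A \<Longrightarrow> f j \<in> multiples u"
  shows "sum f A \<in> multiples u"
proof -
  obtain m where m: "\<And>j. j \<in> A \<Longrightarrow> f j = u * of_int (m j)"
    using assms unfolding multiples_def image_iff by metis
  have "sum f A = u * of_int (sum m A)"
    by (simp add: m sum_distrib_left cong: sum.cong)
  then show ?thesis unfolding multiples_def by blast
qed

lemma multiples_extremal: "b \<in> {- u, 0, u} \<Longrightarrow> b \<in> multiples u"
  unfolding multiples_def image_iff
  by (elim insertE emptyE) (auto intro: exI[of _ "-1"] exI[of _ 0] exI[of _ 1])

lemma multiples_bounded:
  assumes "b \<in> multiples u" "\<bar>b\<bar> \<le> u" "0 < u"
  shows "b \<in> {- u, 0, u}"
proof -
  obtain m :: int where m: "b = u * of_int m" using assms by (auto simp: multiples_def)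
  have "u * \<bar>of_int m\<bar> \<le> u * 1" using assms by (simp add: m abs_mult)
  then have "\<bar>real_of_int m\<bar> \<le> 1" using assms by (simp only: mult_le_cancel_left_pos)
  then have "m \<in> {-1, 0, 1}" by auto
  then show ?thesis using m by auto
qed

section \<open>Uniform symmetric capacities\<close>

locale uniform_capacities =
  fixes fl fu :: "real ^ ('n::finite option)" and u d :: real
  assumes source: "fl $ None = 0" "fu $ None = 0"
    and capacity: "\<And>j. fu $ Some j = u" "\<And>j. fl $ Some j = - u"
    and demand: "0 \<le> d" "d < u"
begin

lemma u_pos: "0 < u"
  using demand by linarith

lemma bounds_within: "- u \<le> fl $ j" "fu $ j \<le> u"
  using source capacity u_pos by (cases j; simp)+

lemma E_set_multiples: "b \<in> E_set fl fu j \<Longrightarrow> b \<in> multiples u"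
  by (cases j) (auto simp: E_set_def source capacity intro: multiples_extremal)

lemma V_set_multiples:
  assumes "v \<in> V_set fl fu d k"
  shows "d - v \<in> multiples u" "fl $ k \<le> v" "v \<le> fu $ k"
proof -
  obtain f :: "real ^ ('n option)" where f: "v = f $ k" "f $ k = d - (\<Sum>j\<in>UNIV - {k}. f $ j)"
    "\<forall>j. j \<noteq> k \<longrightarrow> f $ j \<in> E_set fl fu j" "fl $ k \<le> f $ k" "f $ k \<le> fu $ k"
    using assms by (auto simp: V_set_def)
  have "d - v = (\<Sum>j\<in>UNIV - {k}. f $ j)" using f by simp
  also have "\<dots> \<in> multiples u" using f by (intro multiples_sum E_set_multiples) auto
  finally show "d - v \<in> multiples u" .
  show "fl $ k \<le> v" "v \<le> fu $ k" using f by auto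
qed

text \<open>
  Finiteness makes the hull of \<open>V\<^sub>k\<close>, and hence the disjunct \<open>k\<close>, compact. It holds because the
  elements of \<open>V\<^sub>k\<close> are congruent to \<open>d\<close> modulo \<open>u\<close> and lie in \<open>[-u, u]\<close>.
\<close>

lemma finite_V_set: "finite (V_set fl fu d k)"
proof (rule finite_subset)
  show "V_set fl fu d k \<subseteq> (\<lambda>m::int. d - u * of_int m) ` {-1..2}"
  proof
    fix v assume v: "v \<in> V_set fl fu d k"
    obtain m :: int where m: "d - v = u * of_int m"
      using V_set_multiples(1)[OF v] by (auto simp: multiples_def)
    have vb: "- u \<le> v" "v \<le> u" using V_set_multiples(2,3)[OF v] bounds_within[of k] by linarith+
    have "u * (-1) \<le> u * of_int m" "u * of_int m \<le> u * 2" using m vb demand by linarith+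
    then have "-1 \<le> real_of_int m" "real_of_int m \<le> 2"
      using u_pos by (simp_all only: mult_le_cancel_left_pos)
    then have "m \<in> {-1..2}" by auto
    moreover have "v = d - u * of_int m" using m by simp
    ultimately show "v \<in> (\<lambda>m::int. d - u * of_int m) ` {-1..2}" by blast
  qed
qed simp

lemma V_set_witness:
  assumes "(\<Sum>j\<in>UNIV. f $ j) = d" "\<And>j. j \<noteq> k \<Longrightarrow> f $ j \<in> E_set fl fu j"
    "fl $ k \<le> f $ k" "f $ k \<le> fu $ k"
  shows "f $ k \<in> V_set fl fu d k"
proof -
  have "f $ k = d - (\<Sum>j\<in>UNIV - {k}. f $ j)"
    using assms(1) by (simp add: sum.remove[of UNIV k])
  then show ?thesis using assms unfolding V_set_def by blast
qed

section \<open>The disjuncts lie in the hull of the binary solutions\<close>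

definition disjunct_coord :: "'n option \<Rightarrow> 'n option \<Rightarrow> (real \<times> real) set" where
  "disjunct_coord k j =
    {(a, b). 0 \<le> a \<and> a \<le> 1 \<and> fl $ j * a \<le> b \<and> b \<le> fu $ j * a} \<inter>
    (if j = k then {1} \<times> (convex hull (V_set fl fu d k)) else UNIV)"

lemma disjunct_coord_Some:
  "j \<noteq> k \<Longrightarrow> j = Some i \<Longrightarrow>
    disjunct_coord k j = {(a, b). 0 \<le> a \<and> a \<le> 1 \<and> \<bar>b\<bar> \<le> u * a}"
  by (auto simp: disjunct_coord_def capacity abs_le_iff)

lemma O_set_disjuncts: "O_set fl fu d = (\<Union>k. coupled_polytope (disjunct_coord k) d)"
proof -
  have "{(x, f). (\<forall>i. x $ i \<in> {0..1}) \<and> (\<Sum>j\<in>UNIV. f $ j) = d \<and>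
          (\<forall>j. fl $ j * xcoord x j \<le> f $ j \<and> f $ j \<le> fu $ j * xcoord x j) \<and>
          f $ k \<in> convex hull (V_set fl fu d k) \<and> xcoord x k = 1}
       = coupled_polytope (disjunct_coord k) d" for k
  proof -
    have x: "(\<forall>i. x $ i \<in> {0..1}) \<longleftrightarrow> (\<forall>j. 0 \<le> xcoord x j \<and> xcoord x j \<le> 1)" for x :: "real ^ 'n"
      by (auto simp: split_option_all)
    show ?thesis
      unfolding coupled_polytope_def disjunct_coord_def x by auto
  qed
  then show ?thesis by (simp add: O_set_def)
qed

lemma closed_band: "closed {(a, b). 0 \<le> a \<and> a \<le> 1 \<and> l * a \<le> b \<and> b \<le> r * a}" for l r :: real
  unfolding case_prod_unfold
  by (intro closed_Collect_conj closed_Collect_le continuous_intros)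

lemma convex_band: "convex {(a, b). 0 \<le> a \<and> a \<le> 1 \<and> l * a \<le> b \<and> b \<le> r * a}" for l r :: real
proof -
  have "{(a, b). 0 \<le> a \<and> a \<le> 1 \<and> l * a \<le> b \<and> b \<le> r * a} =
    {p. (- 1, 0) \<bullet> p \<le> 0} \<inter> {p. (1, 0) \<bullet> p \<le> 1} \<inter> {p. (l, - 1) \<bullet> p \<le> 0} \<inter> {p. (- r, 1) \<bullet> p \<le> 0}"
    by auto
  then show ?thesis by (simp add: convex_Int convex_halfspace_le)
qed

lemma band_bounded:
  "{(a, b). 0 \<le> a \<and> a \<le> 1 \<and> fl $ j * a \<le> b \<and> b \<le> fu $ j * a} \<subseteq> {0..1} \<times> {-u..u}"
proof clarsimp
  fix a b :: real
  assume ab: "0 \<le> a" "a \<le> 1" "fl $ j * a \<le> b" "b \<le> fu $ j * a"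
  have "u * a \<le> u * 1" "fu $ j * a \<le> u * a" "- u * a \<le> fl $ j * a"
    using ab bounds_within[of j] u_pos by (intro mult_left_mono mult_right_mono; simp)+
  then show "- u \<le> b \<and> b \<le> u" using ab by auto
qed

lemma Krein_Milman_disjunct:
  "coupled_polytope (disjunct_coord k) d =
    convex hull {z. z extreme_point_of coupled_polytope (disjunct_coord k) d}"
proof (rule Krein_Milman_Minkowski)
  have "closed ({1::real} \<times> (convex hull (V_set fl fu d k)))"
    using finite_V_set by (intro closed_Times) (auto simp: finite_imp_compact_convex_hull compact_imp_closed)
  then have "closed (disjunct_coord k j)" for j
    unfolding disjunct_coord_def by (auto intro!: closed_Int closed_band)
  moreover have "disjunct_coord k j \<subseteq> {0..1} \<times> {-u..u}" for j
    using band_bounded unfolding disjunct_coord_def by blast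
  ultimately show "compact (coupled_polytope (disjunct_coord k) d)"
    by (rule compact_coupled_polytope)
  have "convex (disjunct_coord k j)" for j
    unfolding disjunct_coord_def by (auto intro!: convex_Int convex_band convex_Times)
  then show "convex (coupled_polytope (disjunct_coord k) d)"
    by (rule convex_coupled_polytope)
qed

lemma movable_disjunct:
  assumes mem: "(x, f) \<in> coupled_polytope (disjunct_coord k) d"
    and frac: "if Some i = k then f $ Some i \<notin> V_set fl fu d k else f $ Some i \<notin> {- u, 0, u}"
  shows "movable (disjunct_coord k (Some i)) (x $ i) (f $ Some i)"
proof -
  have coord: "(x $ i, f $ Some i) \<in> disjunct_coord k (Some i)"
    using mem by (metis (mono_tags, lifting) case_prodD coupled_polytope_def mem_Collect_eq xcoord_simps(2))
  show ?thesis
  proof (cases "Some i = k")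
    case True
    have hull: "x $ i = 1" "f $ Some i \<in> convex hull (V_set fl fu d k)"
      using coord True by (auto simp: disjunct_coord_def)
    obtain e where e: "0 < e" "\<And>t. \<bar>t\<bar> \<le> e \<Longrightarrow> f $ Some i + t \<in> convex hull (V_set fl fu d k)"
      using convex_hull_real_not_generator[OF hull(2)] frac True by auto
    have "convex hull (V_set fl fu d k) \<subseteq> {fl $ k..fu $ k}"
      using V_set_multiples(2,3) by (intro hull_minimal) auto
    then have "(x $ i + 0 * t, f $ Some i + t) \<in> disjunct_coord k (Some i)" if "\<bar>t\<bar> \<le> e" for t
      using e(2)[OF that] hull(1) True by (auto simp: disjunct_coord_def)
    then show ?thesis using e(1) unfolding movable_def by blast
  next
    case False
    then show ?thesis
      using coord frac u_pos movable_capacity[of "x $ i" "f $ Some i" u]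
      by (simp add: disjunct_coord_Some)
  qed
qed

text \<open>
  A fractional flow \<open>f\<^sub>j\<close> makes \<open>j\<close> the only movable coordinate. All the other flows are then
  fixed modulo \<open>u\<close>, the flow \<open>f\<^sub>k \<in> V\<^sub>k\<close> being congruent to \<open>d\<close>, and conservation forces
  \<open>f\<^sub>j\<close> to be a multiple of \<open>u\<close>.
\<close>

lemma extreme_point_disjunct_flows:
  assumes ext: "(x, f) extreme_point_of coupled_polytope (disjunct_coord k) d"
    and jk: "j \<noteq> k"
  shows "f $ j \<in> E_set fl fu j"
proof (rule ccontr)
  assume frac: "f $ j \<notin> E_set fl fu j"
  have mem: "(x, f) \<in> coupled_polytope (disjunct_coord k) d"
    using ext by (simp add: extreme_point_of_def)
  then have sum: "(\<Sum>i\<in>UNIV. f $ i) = d"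
    and coord: "\<And>i. (xcoord x i, f $ i) \<in> disjunct_coord k i"
    by (auto simp: coupled_polytope_def)
  have f0: "f $ None = 0"
    using coord[of None] by (auto simp: disjunct_coord_def source)
  obtain m where m: "j = Some m"
    using frac f0 by (cases j) (auto simp: E_set_def source)
  have mov_m: "movable (disjunct_coord k (Some m)) (x $ m) (f $ Some m)"
    using mem frac jk m by (intro movable_disjunct) (auto simp: E_set_def capacity)
  have others: "f $ i \<in> E_set fl fu i" if "i \<noteq> j" "i \<noteq> k" for i
  proof (cases i)
    case None
    then show ?thesis using f0 by (simp add: E_set_def source)
  next
    case (Some i')
    show ?thesis
    proof (rule ccontr)
      assume "f $ i \<notin> E_set fl fu i"
      then have "movable (disjunct_coord k (Some i')) (x $ i') (f $ Some i')"
        using mem that Some by (intro movable_disjunct) (auto simp: E_set_def capacity)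
      then show False using extreme_point_movable_unique[OF ext _ mov_m] that m Some by blast
    qed
  qed
  \<comment> \<open>Outside \<open>V\<^sub>k\<close>, the flow \<open>f\<^sub>k\<close> would make \<open>k\<close> a second movable coordinate. For \<open>k = 0\<close>,
    membership in the hull shows that \<open>V\<^sub>0\<close>, a subset of \<open>{0}\<close>, is not empty.\<close>
  have fk: "f $ k \<in> V_set fl fu d k"
  proof (cases k)
    case None
    have "V_set fl fu d None \<subseteq> {0}" using V_set_multiples(2,3)[of _ None] source by force
    then have "V_set fl fu d None \<noteq> {}" using coord[of None] None by (auto simp: disjunct_coord_def)
    then show ?thesis using \<open>V_set fl fu d None \<subseteq> {0}\<close> f0 None by auto
  next
    case (Some k')
    show ?thesis
    proof (rule ccontr)
      assume "f $ k \<notin> V_set fl fu d k"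
      then have "movable (disjunct_coord k (Some k')) (x $ k') (f $ Some k')"
        using mem Some by (intro movable_disjunct) auto
      then show False using extreme_point_movable_unique[OF ext _ mov_m] jk m Some by blast
    qed
  qed
  have "f $ j = d - f $ k - (\<Sum>i\<in>UNIV - {k} - {j}. f $ i)"
    using sum jk by (simp add: sum.remove[of UNIV k] sum.remove[of "UNIV - {k}" j])
  also have "\<dots> \<in> multiples u"
    using others
    by (intro multiples_diff[OF V_set_multiples(1)[OF fk] multiples_sum] E_set_multiples) auto
  finally have "f $ j \<in> multiples u" .
  moreover have "\<bar>f $ j\<bar> \<le> u"
    using coord[of j] band_bounded[of j] by (force simp: disjunct_coord_def abs_le_iff)
  ultimately show False
    using multiples_bounded u_pos frac m by (fastforce simp: E_set_def capacity)
qed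

text \<open>
  For \<open>i \<noteq> k\<close>, the coordinate \<open>x\<^sub>i\<close> is forced to \<open>1\<close> where the flow is \<open>u\<close> or \<open>-u\<close>, and is
  free in \<open>[0, 1]\<close> where the flow is \<open>0\<close>, so that extremality leaves only the two end points.
\<close>

lemma extreme_point_disjunct_in_S_set:
  assumes ext: "(x, f) extreme_point_of coupled_polytope (disjunct_coord k) d"
  shows "(x, f) \<in> S_set fl fu d"
proof -
  have mem: "(x, f) \<in> coupled_polytope (disjunct_coord k) d"
    using ext by (simp add: extreme_point_of_def)
  then have coord: "\<And>j. (xcoord x j, f $ j) \<in> disjunct_coord k j"
    by (auto simp: coupled_polytope_def)
  have "x $ i \<in> {0, 1}" for i
  proof (cases "Some i = k")
    case True
    then show ?thesis using coord[of "Some i"] by (auto simp: disjunct_coord_def)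
  next
    case False
    then have E: "f $ Some i \<in> {- u, 0, u}"
      using extreme_point_disjunct_flows[OF ext, of "Some i"] by (simp add: E_set_def capacity)
    have c: "0 \<le> x $ i" "x $ i \<le> 1" "\<bar>f $ Some i\<bar> \<le> u * x $ i"
      using coord[of "Some i"] False by (auto simp: disjunct_coord_Some)
    show ?thesis
    proof (cases "f $ Some i = 0")
      case True
      have "min (x $ i) (1 - x $ i) = 0"
        using False True c u_pos
        by (intro extreme_point_x_rigid[OF ext, of i]) (auto simp: disjunct_coord_Some)
      then show ?thesis by (auto simp: min_def split: if_splits)
    next
      case False
      then have "u * 1 \<le> u * x $ i" using E c by auto
      then have "1 \<le> x $ i" using u_pos by (simp only: mult_le_cancel_left_pos)
      then show ?thesis using c by auto
    qed
  qed
  then show ?thesis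
    using mem by (auto simp: S_set_def coupled_polytope_def disjunct_coord_def)
qed

lemma O_set_subset: "O_set fl fu d \<subseteq> convex hull (S_set fl fu d)"
proof -
  have "coupled_polytope (disjunct_coord k) d \<subseteq> convex hull (S_set fl fu d)" for k
    using extreme_point_disjunct_in_S_set[of _ _ k]
    by (subst Krein_Milman_disjunct) (intro hull_mono, auto)
  then show ?thesis by (auto simp: O_set_disjuncts)
qed

section \<open>The binary solutions lie in the hull of the disjuncts\<close>

definition fiber_coord :: "real ^ 'n \<Rightarrow> 'n option \<Rightarrow> (real \<times> real) set" where
  "fiber_coord y j = {xcoord y j} \<times> {fl $ j * xcoord y j..fu $ j * xcoord y j}"

lemma Krein_Milman_fiber:
  assumes y: "\<And>i. y $ i \<in> {0, 1}"
  shows "coupled_polytope (fiber_coord y) d =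
    convex hull {z. z extreme_point_of coupled_polytope (fiber_coord y) d}"
proof (rule Krein_Milman_Minkowski)
  have "0 \<le> xcoord y j \<and> xcoord y j \<le> 1" for j
    using y[of "the j"] by (cases j) auto
  then have "fiber_coord y j \<subseteq> {(a, b). 0 \<le> a \<and> a \<le> 1 \<and> fl $ j * a \<le> b \<and> b \<le> fu $ j * a}" for j
    by (auto simp: fiber_coord_def)
  then have "fiber_coord y j \<subseteq> {0..1} \<times> {-u..u}" for j
    using band_bounded by (rule subset_trans)
  moreover have "closed (fiber_coord y j)" for j
    unfolding fiber_coord_def by (intro closed_Times) auto
  ultimately show "compact (coupled_polytope (fiber_coord y) d)"
    by (intro compact_coupled_polytope)
  show "convex (coupled_polytope (fiber_coord y) d)"
    unfolding fiber_coord_def by (intro convex_coupled_polytope convex_Times) auto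
qed

text \<open>
  An extreme point has at most one fractional flow; its index selects the disjunct, because \<open>x\<close>
  is \<open>1\<close> wherever the flow is fractional. Without a fractional flow the index \<open>0\<close> serves, as \<open>x\<^sub>0 = 1\<close>.
\<close>

lemma extreme_point_fiber_in_O_set:
  assumes y: "\<And>i. y $ i \<in> {0, 1}"
    and ext: "(x, f) extreme_point_of coupled_polytope (fiber_coord y) d"
  shows "(x, f) \<in> O_set fl fu d"
proof -
  have mem: "(x, f) \<in> coupled_polytope (fiber_coord y) d"
    using ext by (simp add: extreme_point_of_def)
  then have sum: "(\<Sum>i\<in>UNIV. f $ i) = d"
    and coord: "\<And>j. (xcoord x j, f $ j) \<in> fiber_coord y j"
    by (auto simp: coupled_polytope_def)
  have xy: "x $ i = y $ i" for i
    using coord[of "Some i"] by (simp add: fiber_coord_def)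
  have xb: "x $ i \<in> {0, 1}" for i
    using xy y by simp
  have bounds: "fl $ j * xcoord x j \<le> f $ j" "f $ j \<le> fu $ j * xcoord x j" for j
    using coord[of j] by (auto simp: fiber_coord_def)
  have f0: "f $ None = 0"
    using bounds[of None] by (simp add: source)
  have fractional_open: "x $ i = 1" if "f $ Some i \<notin> {- u, 0, u}" for i
    using that bounds[of "Some i"] xb[of i] by (auto simp: capacity)
  have mov: "movable (fiber_coord y (Some i)) (x $ i) (f $ Some i)"
    if "f $ Some i \<notin> {- u, 0, u}" for i
    using that bounds[of "Some i"] fractional_open[OF that] xy[of i] unfolding movable_def
    by (intro exI[of _ 0] exI[of _ "u - \<bar>f $ Some i\<bar>"]) (auto simp: fiber_coord_def capacity)
  obtain k where k: "xcoord x k = 1" and rest: "\<And>j. j \<noteq> k \<Longrightarrow> f $ j \<in> E_set fl fu j"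
  proof (cases "\<exists>i. f $ Some i \<notin> {- u, 0, u}")
    case True
    then obtain i where i: "f $ Some i \<notin> {- u, 0, u}" by blast
    have "f $ j \<in> E_set fl fu j" if "j \<noteq> Some i" for j
      using that f0 extreme_point_movable_unique[OF ext mov[OF i] mov]
      by (cases j) (auto simp: E_set_def source capacity)
    then show ?thesis using fractional_open[OF i] that[of "Some i"] by simp
  next
    case False
    have "f $ j \<in> E_set fl fu j" if "j \<noteq> None" for j
      using that False by (cases j) (auto simp: E_set_def capacity)
    then show ?thesis using that[of None] by simp
  qed
  have "f $ k \<in> V_set fl fu d k"
    using sum rest bounds[of k] k by (intro V_set_witness) auto
  then have "f $ k \<in> convex hull (V_set fl fu d k)" by (rule hull_inc)
  moreover have "x $ i \<in> {0..1}" for i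
    using xb[of i] by auto
  ultimately show ?thesis
    using sum bounds k unfolding O_set_def by blast
qed

lemma S_set_subset: "S_set fl fu d \<subseteq> convex hull (O_set fl fu d)"
proof clarify
  fix x f assume xf: "(x, f) \<in> S_set fl fu d"
  then have x: "\<And>i. x $ i \<in> {0, 1}"
    and mem: "(x, f) \<in> coupled_polytope (fiber_coord x) d"
    by (auto simp: S_set_def coupled_polytope_def fiber_coord_def)
  have "coupled_polytope (fiber_coord x) d \<subseteq> convex hull (O_set fl fu d)"
    using extreme_point_fiber_in_O_set[OF x]
    by (subst Krein_Milman_fiber[OF x]) (intro hull_mono, auto)
  then show "(x, f) \<in> convex hull (O_set fl fu d)" using mem by blast
qed

end

theorem proposition6:
  fixes fl fu :: "real ^ ('n::finite option)" and fbar d :: real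
  assumes "fl $ None = 0" and "fu $ None = 0"
    and "\<And>j. fu $ Some j = fbar" and "\<And>j. fl $ Some j = - fbar"
    and "0 \<le> d" and "d < fbar"
  shows "convex hull (O_set fl fu d) = convex hull (S_set fl fu d)"
proof -
  interpret uniform_capacities fl fu fbar d
    by unfold_locales (use assms in auto)
  show ?thesis
    using O_set_subset S_set_subset by (intro equalityI hull_minimal convex_convex_hull)
qed

end
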